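(* Let $G$ be a discrete amenable group, $T$ a finite rooted tree with root $r$ and $T^+=T\setminus\{r\}$, $A\subseteq G$ a set of positive density, and $L\subseteq G$. Let $(g_n)_{n\in\omega}$ be a sequence of functions $g_n:T^+\to G$, and extend each $g_n$ to $T^+\cup L$ by $g_n(x)=x$ for $x\in L$. For every sequence $(\mathcal F_n)_{n\in\omega}$ of finite sets of variable substitution maps for $L,T$, there exists a sequence of functions $b_n:T\to\mathrm{FIN}^T_L$, $t\mapsto b_{n,t}\in\mathrm{FIN}^T_{L,t}$, such that $\mathrm{dom}(b_{n,t})<\mathrm{dom}(b_{n+1,t})$ for all $n,t$, and for every finite nonempty $F\subseteq\omega$, variable substitution maps $\sigma_e\in\mathcal F_e$ and nodes $t_e\in T$ ($e\in F$) such that $\{f_{\sigma_e}(t_e):e\in F\}$ is a chain in $T$, one has $$\prod_{e\in F}\ \prod_{\substack{j\in\mathrm{dom}(b_{e,t_e})\\ b_{e,t_e}(j)\in\mathrm{dom}(\sigma_e)}}\big(g_j\circ\sigma_e\circ b_{e,t_e}\big)(j)\ \in AA^{-1}.$$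
   Context: Density in an amenable group $G$: for $\alpha>0$, $d(A)\ge\alpha$ iff for every finite $F\subseteq G$ and $\varepsilon>0$ there is finite $I\subseteq G$ with $|A\cap I|\ge(\alpha-\varepsilon)|I|$ and $|gI\triangle I|<\varepsilon|I|$ for $g\in F$; positive density means $d(A)\ge\alpha$ for some $\alpha>0$. $AA^{-1}=\{gh^{-1}:g,h\in A\}$. Products over finite index sets are in increasing order of the index. $\omega=\{0,1,\dots\}$; for finite $A,B\subseteq\omega$, $A<B$ means every element of $A$ is below every element of $B$ (vacuous if empty). $T$ is ordered by $t'\le t$ iff $t'$ is a descendant of or equal to $t$; nodes of $T^+$ are regarded as variables, disjoint from $L$. A regressive homomorphism is $f:T\to T$ with $f(t)\ge t$ mapping adjacent nodes to equal or adjacent nodes. $\mathrm{FIN}^T_L$: functions $b:\mathrm{dom}(b)\to L\cup T^+$ with $\mathrm{dom}(b)$ a finite (possibly empty) subset of $\omega$; $\mathrm{FIN}^T_{L,r}$: those with values in $L$; for $t\in T^+$, $\mathrm{FIN}^T_{L,t}$: those for which $\mathrm{ran}(b)\cap T^+$ is a nonempty chain with least element $t$. A variable substitution map for $L,T$ is a partial function $\sigma$ from $\mathrm{dom}(\sigma)\subseteq T^+\cup L$ to $T^+\cup L$ with $L\subseteq\mathrm{dom}(\sigma)$, $\sigma|_L=\mathrm{id}_L$, such that $f_\sigma(t)=\sigma(t)$ if $t\in\mathrm{dom}(\sigma)$ and $\sigma(t)\in T^+$, $f_\sigma(t)=r$ otherwise, is a regressive homomorphism. *)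

theory Defs
  imports Complex_Main "HOL-Algebra.Coset"
begin
text \<open>Amenability in the sense of von Neumann: there is a finitely additive left-invariant
  probability measure \<^term>\<open>\<mu>\<close> on all subsets of the group.\<close>

definition amenable_group :: "('g, 'm) monoid_scheme \<Rightarrow> bool" where
  "amenable_group G \<longleftrightarrow> group G \<and>
     (\<exists>\<mu> :: 'g set \<Rightarrow> real.
        (\<forall>X. X \<subseteq> carrier G \<longrightarrow> \<mu> X \<ge> 0) \<and>
        \<mu> (carrier G) = 1 \<and>
        (\<forall>X Y. X \<subseteq> carrier G \<longrightarrow> Y \<subseteq> carrier G \<longrightarrow> X \<inter> Y = {} \<longrightarrow> \<mu> (X \<union> Y) = \<mu> X + \<mu> Y) \<and>
        (\<forall>g\<in>carrier G. \<forall>X. X \<subseteq> carrier G \<longrightarrow> \<mu> (g <#\<^bsub>G\<^esub> X) = \<mu> X))"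

definition density_ge :: "('g, 'm) monoid_scheme \<Rightarrow> 'g set \<Rightarrow> real \<Rightarrow> bool" where
  "density_ge G A \<alpha> \<longleftrightarrow>
     (\<forall>F (\<epsilon>::real). finite F \<longrightarrow> F \<subseteq> carrier G \<longrightarrow> \<epsilon> > 0 \<longrightarrow>
        (\<exists>I. finite I \<and> I \<subseteq> carrier G \<and>
             real (card (A \<inter> I)) \<ge> (\<alpha> - \<epsilon>) * real (card I) \<and>
             (\<forall>g\<in>F. real (card (sym_diff (g <#\<^bsub>G\<^esub> I) I)) < \<epsilon> * real (card I))))"

definition positive_density :: "('g, 'm) monoid_scheme \<Rightarrow> 'g set \<Rightarrow> bool" where
  "positive_density G A \<longleftrightarrow> (\<exists>\<alpha>>0. density_ge G A \<alpha>)"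

text \<open>Product over a finite index set in increasing order of the index.\<close>

definition ordered_prod :: "('g, 'm) monoid_scheme \<Rightarrow> (nat \<Rightarrow> 'g) \<Rightarrow> nat set \<Rightarrow> 'g" where
  "ordered_prod G h I = foldr (\<otimes>\<^bsub>G\<^esub>) (map h (sorted_list_of_set I)) \<one>\<^bsub>G\<^esub>"

text \<open>\<open>E\<close> is the relation from parents to children.\<close>

definition finite_rooted_tree :: "'t set \<Rightarrow> 't \<Rightarrow> ('t \<times> 't) set \<Rightarrow> bool" where
  "finite_rooted_tree T r E \<longleftrightarrow>
     finite T \<and> r \<in> T \<and> E \<subseteq> T \<times> T \<and>
     (\<forall>s. (s, r) \<notin> E) \<and>
     (\<forall>t\<in>T - {r}. \<exists>!s. (s, t) \<in> E) \<and>
     (\<forall>t\<in>T. (r, t) \<in> E\<^sup>*)"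

text \<open>\<open>tree_le E t' t\<close> is \<open>t' \<le> t\<close>: the node \<open>t'\<close> is a descendant of, or equal to, \<open>t\<close>.
  The root is thus the greatest element.\<close>

definition tree_le :: "('t \<times> 't) set \<Rightarrow> 't \<Rightarrow> 't \<Rightarrow> bool" where
  "tree_le E t' t \<longleftrightarrow> (t, t') \<in> E\<^sup>*"

definition tree_adjacent :: "('t \<times> 't) set \<Rightarrow> 't \<Rightarrow> 't \<Rightarrow> bool" where
  "tree_adjacent E s t \<longleftrightarrow> (s, t) \<in> E \<or> (t, s) \<in> E"

definition tree_chain :: "('t \<times> 't) set \<Rightarrow> 't set \<Rightarrow> bool" where
  "tree_chain E S \<longleftrightarrow> Complete_Partial_Order.chain (tree_le E) S"

definition regressive_hom :: "'t set \<Rightarrow> ('t \<times> 't) set \<Rightarrow> ('t \<Rightarrow> 't) \<Rightarrow> bool" where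
  "regressive_hom T E f \<longleftrightarrow>
     f \<in> T \<rightarrow> T \<and>
     (\<forall>t\<in>T. tree_le E t (f t)) \<and>
     (\<forall>s\<in>T. \<forall>t\<in>T. tree_adjacent E s t \<longrightarrow> f s = f t \<or> tree_adjacent E (f s) (f t))"

text \<open>The disjoint union \<open>L \<union> T\<^sup>+\<close> is \<^term>\<open>L <+> (T - {r})\<close>: letters are tagged by \<^const>\<open>Inl\<close>,
  variables by \<^const>\<open>Inr\<close>.  Partial functions are maps into an option type.\<close>

definition FIN :: "'g set \<Rightarrow> 't set \<Rightarrow> 't \<Rightarrow> (nat \<rightharpoonup> 'g + 't) set" where
  "FIN L T r = {b. finite (dom b) \<and> ran b \<subseteq> L <+> (T - {r})}"

definition FIN_node :: "'g set \<Rightarrow> 't set \<Rightarrow> 't \<Rightarrow> ('t \<times> 't) set \<Rightarrow> 't \<Rightarrow> (nat \<rightharpoonup> 'g + 't) set" where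
  "FIN_node L T r E t =
     (if t = r then {b \<in> FIN L T r. ran b \<subseteq> Inl ` L}
      else {b \<in> FIN L T r.
              let V = {s. Inr s \<in> ran b} in
                tree_chain E V \<and> t \<in> V \<and> (\<forall>s\<in>V. tree_le E t s)})"

definition subst_node_map :: "'t \<Rightarrow> ('g + 't \<rightharpoonup> 'g + 't) \<Rightarrow> 't \<Rightarrow> 't" where
  "subst_node_map r \<sigma> t = (case \<sigma> (Inr t) of Some (Inr s) \<Rightarrow> s | _ \<Rightarrow> r)"

definition var_subst_map ::
    "'g set \<Rightarrow> 't set \<Rightarrow> 't \<Rightarrow> ('t \<times> 't) set \<Rightarrow> ('g + 't \<rightharpoonup> 'g + 't) \<Rightarrow> bool" where
  "var_subst_map L T r E \<sigma> \<longleftrightarrow>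
     dom \<sigma> \<subseteq> L <+> (T - {r}) \<and> ran \<sigma> \<subseteq> L <+> (T - {r}) \<and>
     (\<forall>x\<in>L. \<sigma> (Inl x) = Some (Inl x)) \<and>
     regressive_hom T E (subst_node_map r \<sigma>)"

text \<open>The extension of \<open>g : T\<^sup>+ \<rightarrow> G\<close> by the identity on letters.\<close>

definition extend_letters :: "('t \<Rightarrow> 'g) \<Rightarrow> 'g + 't \<Rightarrow> 'g" where
  "extend_letters g = case_sum id g"

text \<open>The domain of \<^term>\<open>\<sigma> \<circ>\<^sub>m b\<close> is the set of \<^term>\<open>j \<in> dom b\<close> with \<open>b(j) \<in> dom(\<sigma>)\<close>, so this is
  the product of \<open>(g\<^sub>j \<circ> \<sigma> \<circ> b)(j)\<close> over those \<open>j\<close>.\<close>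

definition subst_prod ::
    "('g, 'm) monoid_scheme \<Rightarrow> (nat \<Rightarrow> 't \<Rightarrow> 'g) \<Rightarrow> ('g + 't \<rightharpoonup> 'g + 't) \<Rightarrow> (nat \<rightharpoonup> 'g + 't) \<Rightarrow> 'g" where
  "subst_prod G g \<sigma> b =
     ordered_prod G (\<lambda>j. extend_letters (g j) (the ((\<sigma> \<circ>\<^sub>m b) j))) (dom (\<sigma> \<circ>\<^sub>m b))"

end

theory Submission
  imports Defs "HOL-Library.Ramsey"
begin

text \<open>The words can be chosen with a single variable: \<open>b\<^bsub>n,t\<^esub>\<close> is constantly \<open>t\<close> on an interval \<open>D\<^sub>n\<close> if
  \<open>t \<noteq> r\<close>, and empty if \<open>t = r\<close>.  After substitution, \<open>b\<^bsub>n,t\<^esub>\<close> contributes either the identity or one of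
  finitely many products \<open>\<phi>\<^sub>k(D\<^sub>n) = \<Prod>\<^bsub>j \<in> D\<^sub>n\<^esub> g\<^sub>j(k)\<close>, so it suffices that all products of such elements lie
  in \<open>AA\<inverse>\<close>.  Invariantly: for every product \<open>x\<close> of factors from the first \<open>n\<close> intervals,
  \<open>x\<inverse>A \<inter> A\<close> has positive density.  To extend, one needs an interval \<open>D\<close> with \<open>B \<inter> \<phi>\<^sub>k(D)A\<close> of
  positive density for finitely many \<open>B\<close> (with \<open>B \<inter> A\<close> of positive density) and finitely many \<open>k\<close>.
  Among enough translates of \<open>C = B \<inter> A\<close> by the partial products \<open>h\<^sub>i = \<phi>\<^sub>k([0,i))\<close>, two meet in a set
  of positive density, which gives a pair \<open>i < j\<close> with \<open>C \<inter> \<phi>\<^sub>k([i,j))C\<close> of positive density.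
  Ramsey's theorem provides one pair that serves all \<open>B\<close> and \<open>k\<close>.\<close>

section \<open>A Bonferroni inequality and an application of Ramsey's theorem\<close>

text \<open>Truncated inclusion-exclusion: when \<open>S n\<close> joins the union of the earlier
  sets, the loss is its overlap with that union, which the sets \<open>S j \<inter> S n\<close>
  cover. It bounds from below how much large sets in a common ambient set must overlap.\<close>

lemma sum_card_le_card_UN_plus_pairs:
  fixes S :: "nat \<Rightarrow> 'a set"
  assumes "\<And>i. i < n \<Longrightarrow> finite (S i)"
  shows "(\<Sum>i<n. card (S i)) \<le> card (\<Union>i<n. S i) + (\<Sum>i<n. \<Sum>j<i. card (S j \<inter> S i))"
  using assms
proof (induction n)
  case (Suc n)
  let ?U = "\<Union>i<n. S i"
  have fin: "finite ?U" "finite (S n)" using Suc.prems by auto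
  have "card (?U \<inter> S n) = card (\<Union>j<n. S j \<inter> S n)"
    by (rule arg_cong[where f = card]) auto
  also have "\<dots> \<le> (\<Sum>j<n. card (S j \<inter> S n))"
    by (rule card_UN_le) simp
  finally have "card (?U \<inter> S n) \<le> (\<Sum>j<n. card (S j \<inter> S n))" .
  moreover have "card ?U + card (S n) = card (?U \<union> S n) + card (?U \<inter> S n)"
    by (rule card_Un_Int[OF fin])
  moreover have "(\<Union>i<Suc n. S i) = ?U \<union> S n"
    by (auto simp: less_Suc_eq)
  ultimately show ?case using Suc by fastforce
qed simp

text \<open>Relations are treated one at a time: Ramsey yields an infinite set whose pairs all
  satisfy \<open>R\<close> or all fail it, and the hypothesis excludes failure. Homogeneity for
  earlier relations passes to subsets.\<close>

lemma infinite_simultaneously_homogeneous: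
  fixes P :: "(nat \<Rightarrow> nat \<Rightarrow> bool) set" and Z :: "nat set"
  assumes "finite P" and "infinite Z"
    and "\<And>R Y. R \<in> P \<Longrightarrow> infinite Y \<Longrightarrow> \<exists>i\<in>Y. \<exists>j\<in>Y. i < j \<and> R i j"
  shows "\<exists>Y\<subseteq>Z. infinite Y \<and> (\<forall>R\<in>P. \<forall>i\<in>Y. \<forall>j\<in>Y. i < j \<longrightarrow> R i j)"
  using assms(1,3)
proof (induction P)
  case empty
  then show ?case using assms(2) by blast
next
  case (insert R P)
  then obtain Y where Y: "Y \<subseteq> Z" "infinite Y" "\<forall>R\<in>P. \<forall>i\<in>Y. \<forall>j\<in>Y. i < j \<longrightarrow> R i j"
    by blast
  \<comment> \<open>\<open>Ramsey2\<close> colours unordered pairs; \<open>Min\<close> and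
    \<open>Max\<close> recover their order.\<close>
  define f :: "nat set \<Rightarrow> nat" where "f = (\<lambda>X. if R (Min X) (Max X) then 1 else 0)"
  have "\<forall>x\<in>Y. \<forall>y\<in>Y. x \<noteq> y \<longrightarrow> f {x, y} < 2" by (simp add: f_def)
  from Ramsey2[OF Y(2) this] obtain X c where
    X: "X \<subseteq> Y" "infinite X" "\<forall>x\<in>X. \<forall>y\<in>X. x \<noteq> y \<longrightarrow> f {x, y} = c" by blast
  obtain i j where ij: "i \<in> X" "j \<in> X" "i < j" "R i j"
    using insert.prems[of R X] X(2) by blast
  have f: "f {x, y} = (if R x y then 1 else 0)" if "x < y" for x y
    using that by (simp add: f_def)
  have "c = 1" using X(3) ij f[OF ij(3)] by force
  then have "R x y" if "x \<in> X" "y \<in> X" "x < y" for x y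
    using X(3) that f[OF that(3)] by (metis less_irrefl zero_neq_one)
  moreover have "\<forall>Q\<in>P. \<forall>i\<in>X. \<forall>j\<in>X. i < j \<longrightarrow> Q i j"
    using X(1) Y(3) by (meson subsetD)
  ultimately have "\<forall>Q\<in>insert R P. \<forall>i\<in>X. \<forall>j\<in>X. i < j \<longrightarrow> Q i j" by simp
  moreover have "X \<subseteq> Z" using X(1) Y(1) by (rule subset_trans)
  ultimately show ?case using X(2) by (intro exI[of _ X] conjI)
qed

section \<open>Positive density: monotonicity, translation and overlap of translates\<close>

lemma density_geE:
  assumes "density_ge G A \<alpha>" and "finite F" and "F \<subseteq> carrier G" and "\<epsilon> > 0"
  obtains I where "finite I" and "I \<subseteq> carrier G"
    and "real (card (A \<inter> I)) \<ge> (\<alpha> - \<epsilon>) * real (card I)"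
    and "\<forall>g\<in>F. real (card (sym_diff (g <#\<^bsub>G\<^esub> I) I)) < \<epsilon> * real (card I)"
  using assms unfolding density_ge_def by metis

lemma positive_density_mono:
  assumes "positive_density G X" and "X \<subseteq> Y"
  shows "positive_density G Y"
proof -
  obtain \<alpha> where \<alpha>: "\<alpha> > 0" "density_ge G X \<alpha>"
    using assms(1) unfolding positive_density_def by blast
  have "density_ge G Y \<alpha>"
    unfolding density_ge_def
  proof (intro allI impI)
    fix F and \<epsilon> :: real
    assume "finite F" "F \<subseteq> carrier G" "\<epsilon> > 0"
    then obtain I where I: "finite I" "I \<subseteq> carrier G"
      "real (card (X \<inter> I)) \<ge> (\<alpha> - \<epsilon>) * real (card I)"
      "\<forall>g\<in>F. real (card (sym_diff (g <#\<^bsub>G\<^esub> I) I)) < \<epsilon> * real (card I)"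
      by (rule density_geE[OF \<alpha>(2)])
    have "card (X \<inter> I) \<le> card (Y \<inter> I)"
      using I(1) assms(2) by (intro card_mono) auto
    then show "\<exists>I. finite I \<and> I \<subseteq> carrier G \<and> real (card (Y \<inter> I)) \<ge> (\<alpha> - \<epsilon>) * real (card I) \<and>
      (\<forall>g\<in>F. real (card (sym_diff (g <#\<^bsub>G\<^esub> I) I)) < \<epsilon> * real (card I))"
      using I by (intro exI[of _ I]) linarith
  qed
  then show ?thesis using \<alpha>(1) unfolding positive_density_def by blast
qed

context group
begin

lemma positive_density_nonempty:
  assumes "positive_density G X"
  shows "X \<noteq> {}"
proof
  assume "X = {}"
  obtain \<alpha> where \<alpha>: "\<alpha> > 0" "density_ge G X \<alpha>"
    using assms unfolding positive_density_def by blast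
  \<comment> \<open>A nonempty test set supplies a strict bound
    \<open>< \<alpha> / 2 * real (card I)\<close>, which excludes \<open>I = {}\<close>.\<close>
  have "finite {\<one>}" "{\<one>} \<subseteq> carrier G" "\<alpha> / 2 > 0" using \<alpha>(1) by auto
  then obtain I where I: "real (card (X \<inter> I)) \<ge> (\<alpha> - \<alpha> / 2) * real (card I)"
    "\<forall>g\<in>{\<one>}. real (card (sym_diff (g <# I) I)) < \<alpha> / 2 * real (card I)"
    by (rule density_geE[OF \<alpha>(2)])
  have "0 < \<alpha> / 2 * real (card I)"
    using I(2) by (meson insertI1 le_less_trans of_nat_0_le_iff)
  then show False using I(1) \<open>X = {}\<close> by simp
qed

text \<open>Multiplication by \<open>h\<close> is injective and sends \<open>X \<inter> I\<close>
  into \<open>h <# X\<close>; image points outside \<open>I\<close> lie in \<open>h <# I\<close> and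
  so are counted by the symmetric difference.\<close>

lemma card_Int_le_translate:
  assumes "finite I" and "I \<subseteq> carrier G" and "X \<subseteq> carrier G" and "h \<in> carrier G"
  shows "card (X \<inter> I) \<le> card ((h <# X) \<inter> I) + card (sym_diff (h <# I) I)"
proof -
  have fin: "finite (h <# I)" using assms(1) by (simp add: l_coset_def)
  have "card (X \<inter> I) = card ((\<lambda>x. h \<otimes> x) ` (X \<inter> I))"
    using assms by (intro card_image[symmetric] inj_on_subset[OF inj_on_cmult]) auto
  also have "\<dots> \<le> card (((h <# X) \<inter> I) \<union> sym_diff (h <# I) I)"
    using assms(1) fin by (intro card_mono) (auto simp: l_coset_def)
  also have "\<dots> \<le> card ((h <# X) \<inter> I) + card (sym_diff (h <# I) I)"
    by (rule card_Un_le)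
  finally show ?thesis .
qed

lemma positive_density_translate:
  assumes "positive_density G X" and "X \<subseteq> carrier G" and "h \<in> carrier G"
  shows "positive_density G (h <# X)"
proof -
  obtain \<alpha> where \<alpha>: "\<alpha> > 0" "density_ge G X \<alpha>"
    using assms(1) unfolding positive_density_def by blast
  have "density_ge G (h <# X) \<alpha>"
    unfolding density_ge_def
  proof (intro allI impI)
    fix F and \<epsilon> :: real
    assume "finite F" "F \<subseteq> carrier G" "\<epsilon> > 0"
    \<comment> \<open>Half of \<open>\<epsilon>\<close> pays for the density of \<open>X\<close> in
      \<open>I\<close>, the other half for moving \<open>I\<close> by \<open>h\<close>, which is why
      \<open>h\<close> joins the test set.\<close>
    then have "finite (insert h F)" "insert h F \<subseteq> carrier G" "\<epsilon> / 2 > 0"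
      using assms(3) by auto
    then obtain I where I: "finite I" "I \<subseteq> carrier G"
      "real (card (X \<inter> I)) \<ge> (\<alpha> - \<epsilon> / 2) * real (card I)"
      "\<forall>g\<in>insert h F. real (card (sym_diff (g <# I) I)) < \<epsilon> / 2 * real (card I)"
      by (rule density_geE[OF \<alpha>(2)])
    have half: "\<epsilon> / 2 * real (card I) \<le> \<epsilon> * real (card I)"
      using \<open>\<epsilon> > 0\<close> by (intro mult_right_mono) auto
    have "real (card (X \<inter> I)) \<le> real (card ((h <# X) \<inter> I)) + real (card (sym_diff (h <# I) I))"
      using card_Int_le_translate[OF I(1,2) assms(2,3)] by linarith
    moreover have "real (card (sym_diff (h <# I) I)) < \<epsilon> / 2 * real (card I)"
      using I(4) by blast
    ultimately have "real (card ((h <# X) \<inter> I)) \<ge> (\<alpha> - \<epsilon>) * real (card I)"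
      using I(3) by (simp add: left_diff_distrib)
    moreover have "\<forall>g\<in>F. real (card (sym_diff (g <# I) I)) < \<epsilon> * real (card I)"
      using I(4) half by fastforce
    ultimately show "\<exists>I. finite I \<and> I \<subseteq> carrier G \<and>
        real (card ((h <# X) \<inter> I)) \<ge> (\<alpha> - \<epsilon>) * real (card I) \<and>
        (\<forall>g\<in>F. real (card (sym_diff (g <# I) I)) < \<epsilon> * real (card I))"
      using I(1,2) by blast
  qed
  then show ?thesis using \<alpha>(1) unfolding positive_density_def by blast
qed

text \<open>Poincare-type pigeonhole: in one sufficiently invariant finite set, \<open>N\<close>
  translates each occupy a proportion close to \<open>\<alpha>\<close> with
  \<open>N * \<alpha> \<ge> 2\<close>, so they cannot all be nearly disjoint.\<close>

lemma positive_density_translates_meet: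
  fixes h :: "nat \<Rightarrow> 'a"
  assumes "positive_density G C" and "C \<subseteq> carrier G" and h: "\<And>i. h i \<in> carrier G"
  shows "\<exists>i j. i < j \<and> positive_density G ((h i <# C) \<inter> (h j <# C))"
proof (rule ccontr)
  assume contra: "\<not> ?thesis"
  obtain \<alpha> where \<alpha>: "\<alpha> > 0" "density_ge G C \<alpha>"
    using assms(1) unfolding positive_density_def by blast
  obtain N :: nat where N: "2 / \<alpha> \<le> real N" using real_arch_simple by blast
  then have N\<alpha>: "real N * \<alpha> \<ge> 2" using \<alpha>(1) by (simp add: field_simps)
  then have "N > 0" by (cases N) auto
  \<comment> \<open>At most \<open>N * N\<close> pairs, each overlapping in at most
    \<open>\<delta> * n\<close> points, contribute at most \<open>n / 4\<close>.\<close>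
  define \<delta> :: real where "\<delta> = 1 / (4 * real N * real N)"
  have "\<delta> > 0" using \<open>N > 0\<close> by (simp add: \<delta>_def)
  define P where "P = {(i, j). i < j \<and> j < N}"
  have "P \<subseteq> {..<N} \<times> {..<N}" by (auto simp: P_def)
  then have "finite P" by (rule finite_subset) simp
  define M where "M = (\<lambda>(i, j). (h i <# C) \<inter> (h j <# C))"
  \<comment> \<open>Negating density at level \<open>\<delta>\<close> gives sparseness in every
    sufficiently invariant set, not just in some. Hence a single \<open>I\<close> can witness the
    sparseness of all pairs and the density of \<open>C\<close>.\<close>
  have "\<forall>p\<in>P. \<exists>F\<epsilon>. finite (fst F\<epsilon>) \<and> fst F\<epsilon> \<subseteq> carrier G \<and> snd F\<epsilon> > (0::real) \<and>
      (\<forall>I. finite I \<longrightarrow> I \<subseteq> carrier G \<longrightarrow>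
        (\<forall>g\<in>fst F\<epsilon>. real (card (sym_diff (g <# I) I)) < snd F\<epsilon> * real (card I)) \<longrightarrow>
        real (card (M p \<inter> I)) < (\<delta> - snd F\<epsilon>) * real (card I))"
  proof
    fix p assume "p \<in> P"
    then obtain i j where "p = (i, j)" "i < j" by (auto simp: P_def)
    then have "\<not> positive_density G (M p)" using contra by (auto simp: M_def)
    then have "\<not> density_ge G (M p) \<delta>"
      using \<open>\<delta> > 0\<close> by (auto simp: positive_density_def)
    then obtain F and e :: real where Fe: "finite F" "F \<subseteq> carrier G" "e > 0"
      and sparse: "\<not> (\<exists>I. finite I \<and> I \<subseteq> carrier G \<and>
        real (card (M p \<inter> I)) \<ge> (\<delta> - e) * real (card I) \<and>
        (\<forall>g\<in>F. real (card (sym_diff (g <# I) I)) < e * real (card I)))"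
      unfolding density_ge_def by blast
    have "real (card (M p \<inter> I)) < (\<delta> - e) * real (card I)"
      if "finite I" "I \<subseteq> carrier G"
        "\<forall>g\<in>F. real (card (sym_diff (g <# I) I)) < e * real (card I)" for I
      using sparse that by (meson not_le)
    then show "\<exists>F\<epsilon>. finite (fst F\<epsilon>) \<and> fst F\<epsilon> \<subseteq> carrier G \<and> snd F\<epsilon> > (0::real) \<and>
      (\<forall>I. finite I \<longrightarrow> I \<subseteq> carrier G \<longrightarrow>
        (\<forall>g\<in>fst F\<epsilon>. real (card (sym_diff (g <# I) I)) < snd F\<epsilon> * real (card I)) \<longrightarrow>
        real (card (M p \<inter> I)) < (\<delta> - snd F\<epsilon>) * real (card I))"
      using Fe by (intro exI[of _ "(F, e)"]) simp
  qed
  from bchoice[OF this] obtain W where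
    W: "\<forall>p\<in>P. finite (fst (W p)) \<and> fst (W p) \<subseteq> carrier G \<and> snd (W p) > (0::real) \<and>
      (\<forall>I. finite I \<longrightarrow> I \<subseteq> carrier G \<longrightarrow>
        (\<forall>g\<in>fst (W p). real (card (sym_diff (g <# I) I)) < snd (W p) * real (card I)) \<longrightarrow>
        real (card (M p \<inter> I)) < (\<delta> - snd (W p)) * real (card I))" by blast
  define F where "F = (\<Union>p\<in>P. fst (W p)) \<union> h ` {..<N}"
  \<comment> \<open>Below all the tolerances of the pairs, and small enough that the loss
    \<open>2 * \<epsilon> * N\<close> is at most \<open>1 / 4\<close>.\<close>
  define \<epsilon> where "\<epsilon> = Min (insert (1 / (8 * real N)) ((\<lambda>p. snd (W p)) ` P))"
  have "finite F" "F \<subseteq> carrier G"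
    using W \<open>finite P\<close> h by (auto simp: F_def)
  have fin\<epsilon>: "finite (insert (1 / (8 * real N)) ((\<lambda>p. snd (W p)) ` P))"
    using \<open>finite P\<close> by simp
  have "\<epsilon> > 0"
    unfolding \<epsilon>_def using fin\<epsilon> W \<open>N > 0\<close> by (subst Min_gr_iff) auto
  have \<epsilon>N: "\<epsilon> \<le> 1 / (8 * real N)" unfolding \<epsilon>_def using fin\<epsilon> by (intro Min_le) auto
  have \<epsilon>W: "\<epsilon> \<le> snd (W p)" if "p \<in> P" for p
    unfolding \<epsilon>_def using fin\<epsilon> that by (intro Min_le) auto
  obtain I where I: "finite I" "I \<subseteq> carrier G"
    "real (card (C \<inter> I)) \<ge> (\<alpha> - \<epsilon>) * real (card I)"
    "\<forall>g\<in>F. real (card (sym_diff (g <# I) I)) < \<epsilon> * real (card I)"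
    by (rule density_geE[OF \<alpha>(2) \<open>finite F\<close> \<open>F \<subseteq> carrier G\<close> \<open>\<epsilon> > 0\<close>])
  define n where "n = real (card I)"
  \<comment> \<open>Again a nonempty test set forces \<open>I\<close> to be nonempty.\<close>
  have "h 0 \<in> F" using \<open>N > 0\<close> by (auto simp: F_def)
  then have "0 < \<epsilon> * n"
    using I(4) unfolding n_def by (meson le_less_trans of_nat_0_le_iff)
  then have "n > 0" using \<open>\<epsilon> > 0\<close> by (simp add: zero_less_mult_iff)
  define S where "S = (\<lambda>i. (h i <# C) \<inter> I)"
  have S_ge: "real (card (S i)) \<ge> (\<alpha> - 2 * \<epsilon>) * n" if "i < N" for i
  proof -
    have "h i \<in> F" using that by (auto simp: F_def)
    then have "real (card (sym_diff (h i <# I) I)) < \<epsilon> * n" using I(4) by (simp add: n_def)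
    moreover have "real (card (C \<inter> I)) \<le> real (card (S i)) + real (card (sym_diff (h i <# I) I))"
      using card_Int_le_translate[OF I(1,2) assms(2) h[of i]] unfolding S_def by linarith
    ultimately show ?thesis using I(3) by (simp add: n_def left_diff_distrib)
  qed
  have pair_le: "real (card (S j \<inter> S i)) \<le> \<delta> * n" if "j < i" "i < N" for i j
  proof -
    have p: "(j, i) \<in> P" using that by (simp add: P_def)
    have "\<forall>g\<in>fst (W (j, i)). real (card (sym_diff (g <# I) I)) < snd (W (j, i)) * real (card I)"
    proof
      fix x assume "x \<in> fst (W (j, i))"
      then have "real (card (sym_diff (x <# I) I)) < \<epsilon> * n"
        using p I(4) by (auto simp: F_def n_def)
      also have "\<dots> \<le> snd (W (j, i)) * n"
        using \<epsilon>W[OF p] \<open>n > 0\<close> by simp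
      finally show "real (card (sym_diff (x <# I) I)) < snd (W (j, i)) * real (card I)"
        by (simp add: n_def)
    qed
    then have "real (card (M (j, i) \<inter> I)) < (\<delta> - snd (W (j, i))) * n"
      using W p I(1,2) by (simp add: n_def)
    also have "\<dots> \<le> \<delta> * n" using W p \<open>n > 0\<close> by (intro mult_right_mono) auto
    also have "M (j, i) \<inter> I = S j \<inter> S i" by (auto simp: M_def S_def)
    finally show ?thesis by simp
  qed
  \<comment> \<open>Counting the translates gives at most \<open>5 / 4 * n\<close>, while the choice
    of \<open>N\<close> and \<open>\<epsilon>\<close> gives at least
    \<open>7 / 4 * n\<close>.\<close>
  have "real N * ((\<alpha> - 2 * \<epsilon>) * n) = (\<Sum>i<N. (\<alpha> - 2 * \<epsilon>) * n)" by simp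
  also have "\<dots> \<le> (\<Sum>i<N. real (card (S i)))"
    using S_ge by (intro sum_mono) auto
  also have "\<dots> \<le> real (card (\<Union>i<N. S i)) + (\<Sum>i<N. \<Sum>j<i. real (card (S j \<inter> S i)))"
    using sum_card_le_card_UN_plus_pairs[of N S] I(1)
    by (simp add: S_def flip: of_nat_sum of_nat_add)
  also have "real (card (\<Union>i<N. S i)) \<le> n"
    unfolding n_def S_def using I(1) by (intro of_nat_mono card_mono) auto
  also have "(\<Sum>i<N. \<Sum>j<i. real (card (S j \<inter> S i))) \<le> (\<Sum>i<N. \<Sum>j<N. \<delta> * n)"
  proof (rule sum_mono)
    fix i assume i: "i \<in> {..<N}"
    have "(\<Sum>j<i. real (card (S j \<inter> S i))) \<le> (\<Sum>j<i. \<delta> * n)"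
      using pair_le i by (intro sum_mono) auto
    also have "\<dots> \<le> (\<Sum>j<N. \<delta> * n)"
      using i \<open>\<delta> > 0\<close> \<open>n > 0\<close> by (intro sum_mono2) auto
    finally show "(\<Sum>j<i. real (card (S j \<inter> S i))) \<le> (\<Sum>j<N. \<delta> * n)" .
  qed
  also have "(\<Sum>i<N. \<Sum>j<N. \<delta> * n) = n / 4"
    using \<open>N > 0\<close> by (simp add: \<delta>_def field_simps)
  finally have upper: "real N * ((\<alpha> - 2 * \<epsilon>) * n) \<le> n + n / 4" by simp
  have "real N * \<epsilon> \<le> 1 / 8" using \<epsilon>N \<open>N > 0\<close> by (simp add: field_simps)
  then have "real N * (\<alpha> - 2 * \<epsilon>) \<ge> 7 / 4"
    using N\<alpha> by (simp add: right_diff_distrib)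
  then have "7 / 4 * n \<le> real N * (\<alpha> - 2 * \<epsilon>) * n"
    using \<open>n > 0\<close> by (intro mult_right_mono) auto
  then show False using upper \<open>n > 0\<close> by simp
qed

section \<open>Ordered products in a group\<close>

lemma ordered_prod_empty [simp]: "ordered_prod G c {} = \<one>"
  by (simp add: ordered_prod_def)

lemma foldr_mult_closed:
  assumes "set xs \<subseteq> carrier G"
  shows "foldr (\<otimes>) xs \<one> \<in> carrier G"
  using assms by (induction xs) auto

lemma foldr_mult_snoc:
  assumes "set xs \<subseteq> carrier G" and "x \<in> carrier G"
  shows "foldr (\<otimes>) (xs @ [x]) \<one> = foldr (\<otimes>) xs \<one> \<otimes> x"
  using assms by (induction xs) (auto simp: m_assoc foldr_mult_closed)

lemma ordered_prod_closed:
  assumes "finite I" and "\<And>i. i \<in> I \<Longrightarrow> c i \<in> carrier G"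
  shows "ordered_prod G c I \<in> carrier G"
  unfolding ordered_prod_def using assms by (intro foldr_mult_closed) auto

lemma ordered_prod_insert_greatest:
  assumes "finite I" and "\<And>i. i \<in> I \<Longrightarrow> i < m" and "\<And>i. i \<in> insert m I \<Longrightarrow> c i \<in> carrier G"
  shows "ordered_prod G c (insert m I) = ordered_prod G c I \<otimes> c m"
proof -
  have "m \<notin> I" using assms(2) by blast
  moreover have "\<forall>x\<in>set (sorted_list_of_set I). x \<le> m"
    using assms(1,2) by (auto intro: less_imp_le)
  ultimately have "sorted_list_of_set (insert m I) = sorted_list_of_set I @ [m]"
    using assms(1) by (simp add: sorted_insort_is_snoc)
  moreover have "foldr (\<otimes>) (map c (sorted_list_of_set I) @ [c m]) \<one> =
      foldr (\<otimes>) (map c (sorted_list_of_set I)) \<one> \<otimes> c m"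
    using assms by (intro foldr_mult_snoc) auto
  ultimately show ?thesis by (simp add: ordered_prod_def)
qed

text \<open>Makes every interval product a quotient of two initial products, so that comparing two
  translates by initial products yields an interval product.\<close>

lemma ordered_prod_interval:
  assumes "i \<le> j" and c: "\<And>m. c m \<in> carrier G"
  shows "ordered_prod G c {..<i} \<otimes> ordered_prod G c {i..<j} = ordered_prod G c {..<j}"
  using assms(1)
proof (induction j rule: dec_induct)
  case base
  then show ?case by (simp add: ordered_prod_closed c)
next
  case (step j)
  have 1: "ordered_prod G c {i..<Suc j} = ordered_prod G c {i..<j} \<otimes> c j"
    using ordered_prod_insert_greatest[of "{i..<j}" j c] step c by (simp add: atLeastLessThanSuc)
  have 2: "ordered_prod G c {..<Suc j} = ordered_prod G c {..<j} \<otimes> c j"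
    using ordered_prod_insert_greatest[of "{..<j}" j c] c by (simp add: lessThan_Suc)
  show ?case
    unfolding 1 2 step.IH[symmetric] by (simp add: m_assoc ordered_prod_closed c)
qed

section \<open>Returns of dense sets along interval products\<close>

lemma positive_density_interval_return:
  assumes "infinite Y" and C: "positive_density G C" "C \<subseteq> carrier G"
    and c: "\<And>m. c m \<in> carrier G"
  shows "\<exists>i\<in>Y. \<exists>j\<in>Y. i < j \<and> positive_density G (C \<inter> (ordered_prod G c {i..<j} <# C))"
proof -
  define h where "h = (\<lambda>i. ordered_prod G c {..<i})"
  have h: "h i \<in> carrier G" for i by (simp add: h_def ordered_prod_closed c)
  \<comment> \<open>Enumerating \<open>Y\<close> makes both endpoints fall in the prescribed
    infinite set, as the Ramsey argument requires.\<close>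
  obtain p q where "p < q" and
    pos: "positive_density G ((h (enumerate Y p) <# C) \<inter> (h (enumerate Y q) <# C))"
    using positive_density_translates_meet[OF C, of "\<lambda>p. h (enumerate Y p)"] h by blast
  define i j where "i = enumerate Y p" and "j = enumerate Y q"
  have ij: "i \<in> Y" "j \<in> Y" "i < j"
    using assms(1) \<open>p < q\<close> by (auto simp: i_def j_def enumerate_in_set enumerate_mono)
  let ?x = "ordered_prod G c {i..<j}"
  have x: "?x \<in> carrier G" by (simp add: ordered_prod_closed c)
  have hj: "h j = h i \<otimes> ?x"
    using ordered_prod_interval[of i j c] ij c by (simp add: h_def)
  \<comment> \<open>Translating back by \<open>inv (h i)\<close> turns the two translates into
    \<open>C\<close> and \<open>?x <# C\<close>, since
    \<open>h j = h i \<otimes> ?x\<close>.\<close>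
  have "positive_density G (inv (h i) <# ((h i <# C) \<inter> (h j <# C)))"
    using pos h l_coset_subset_G[OF C(2) h] unfolding i_def j_def
    by (intro positive_density_translate le_infI1) auto
  moreover have "inv (h i) <# ((h i <# C) \<inter> (h j <# C)) \<subseteq> C \<inter> (?x <# C)"
  proof -
    have "inv (h i) <# ((h i <# C) \<inter> (h j <# C)) \<subseteq>
        (inv (h i) <# (h i <# C)) \<inter> (inv (h i) <# (h j <# C))"
      by (auto simp: l_coset_def)
    also have "inv (h i) <# (h i <# C) = C"
      using C(2) h by (simp add: lcos_m_assoc lcos_mult_one)
    also have "inv (h i) <# (h j <# C) = ?x <# C"
      using C(2) h[of i] x by (simp add: hj lcos_m_assoc m_assoc[symmetric])
    finally show ?thesis .
  qed
  ultimately show ?thesis using ij positive_density_mono by blast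
qed

lemma positive_density_simultaneous_return:
  assumes "finite \<C>" and "finite K"
    and \<C>: "\<And>C. C \<in> \<C> \<Longrightarrow> positive_density G C \<and> C \<subseteq> carrier G"
    and c: "\<And>k m. k \<in> K \<Longrightarrow> c k m \<in> carrier G"
  shows "\<exists>i j. n \<le> i \<and> i < j \<and>
    (\<forall>C\<in>\<C>. \<forall>k\<in>K. positive_density G (C \<inter> (ordered_prod G (c k) {i..<j} <# C)))"
proof -
  define R where "R = (\<lambda>(C, k) i j. positive_density G (C \<inter> (ordered_prod G (c k) {i..<j} <# C)))"
  \<comment> \<open>There is one relation for each pair \<open>(C, k)\<close>; starting Ramsey
    inside \<open>{n..}\<close> gives the lower bound on \<open>i\<close>.\<close>
  have "\<exists>Y\<subseteq>{n..}. infinite Y \<and> (\<forall>Q\<in>R ` (\<C> \<times> K). \<forall>i\<in>Y. \<forall>j\<in>Y. i < j \<longrightarrow> Q i j)"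
  proof (rule infinite_simultaneously_homogeneous)
    show "finite (R ` (\<C> \<times> K))" using assms(1,2) by simp
    show "infinite {n..}" by (rule infinite_Ici)
    fix Q and Y :: "nat set" assume "Q \<in> R ` (\<C> \<times> K)" "infinite Y"
    then show "\<exists>i\<in>Y. \<exists>j\<in>Y. i < j \<and> Q i j"
      using positive_density_interval_return \<C> c by (auto simp: R_def)
  qed
  then obtain Y where Y: "Y \<subseteq> {n..}" "infinite Y"
    and hom: "\<forall>Q\<in>R ` (\<C> \<times> K). \<forall>i\<in>Y. \<forall>j\<in>Y. i < j \<longrightarrow> Q i j" by blast
  obtain i where i: "i \<in> Y" using Y(2) by fastforce
  obtain j where j: "j \<in> Y" "i < j" using Y(2) infinite_nat_iff_unbounded by blast
  have "\<forall>C\<in>\<C>. \<forall>k\<in>K. R (C, k) i j" using hom i j by blast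
  then show ?thesis using Y(1) i j unfolding R_def by auto
qed

section \<open>Inductive choice of the intervals\<close>

text \<open>The members are meant to be the sets \<open>inv x <# A\<close> for the products
  \<open>x\<close> built so far. Their meeting \<open>A\<close> keeps \<open>x\<close> in the
  difference set, and finiteness allows the next simultaneous return.\<close>

definition good_family :: "'a set \<Rightarrow> 'a set set \<Rightarrow> bool" where
  "good_family A \<B> \<longleftrightarrow> finite \<B> \<and> (\<forall>B\<in>\<B>. B \<subseteq> carrier G \<and> positive_density G (B \<inter> A))"

text \<open>Appending a factor on the right of a product translates the corresponding set by the
  inverse factor on the left. Returns are sought for the sets \<open>B \<inter> A\<close>, so that
  the new translate of \<open>B\<close> still meets \<open>A\<close> densely.\<close>

lemma good_family_step:
  assumes "A \<subseteq> carrier G" and \<B>: "good_family A \<B>" and "finite K"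
    and c: "\<And>k m. k \<in> K \<Longrightarrow> c k m \<in> carrier G"
  shows "\<exists>i j \<B>'. n \<le> i \<and> i < j \<and> good_family A \<B>' \<and> \<B> \<subseteq> \<B>' \<and>
    (\<forall>B\<in>\<B>. \<forall>k\<in>K. inv (ordered_prod G (c k) {i..<j}) <# B \<in> \<B>')"
proof -
  define \<C> where "\<C> = (\<lambda>B. B \<inter> A) ` \<B>"
  have fin: "finite \<C>"
    using \<B> unfolding good_family_def \<C>_def by blast
  have \<C>: "positive_density G C \<and> C \<subseteq> carrier G" if "C \<in> \<C>" for C
    using that \<B> unfolding good_family_def \<C>_def by blast
  obtain i j where ij: "n \<le> i" "i < j"
    and ret: "\<forall>C\<in>\<C>. \<forall>k\<in>K. positive_density G (C \<inter> (ordered_prod G (c k) {i..<j} <# C))"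
    using positive_density_simultaneous_return[where c = c and n = n, OF fin \<open>finite K\<close> \<C>] c
    by blast
  have pos: "positive_density G ((B \<inter> A) \<inter> (ordered_prod G (c k) {i..<j} <# (B \<inter> A)))"
    if "B \<in> \<B>" "k \<in> K" for B k
    using ret that unfolding \<C>_def by blast
  define \<phi> where "\<phi> = (\<lambda>k. ordered_prod G (c k) {i..<j})"
  have \<phi>: "\<phi> k \<in> carrier G" if "k \<in> K" for k
    unfolding \<phi>_def using c that by (intro ordered_prod_closed) auto
  define \<B>' where "\<B>' = \<B> \<union> (\<lambda>(B, k). inv (\<phi> k) <# B) ` (\<B> \<times> K)"
  have "inv (\<phi> k) <# B \<subseteq> carrier G \<and> positive_density G ((inv (\<phi> k) <# B) \<inter> A)"
    if "B \<in> \<B>" "k \<in> K" for B k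
  proof -
    have B: "B \<subseteq> carrier G" using \<B> that by (simp add: good_family_def)
    have "positive_density G ((B \<inter> A) \<inter> (\<phi> k <# (B \<inter> A)))"
      using pos[OF that] by (simp add: \<phi>_def)
    then have "positive_density G (inv (\<phi> k) <# ((B \<inter> A) \<inter> (\<phi> k <# (B \<inter> A))))"
      using B \<phi>[OF that(2)] by (intro positive_density_translate) auto
    \<comment> \<open>The first copy of \<open>B \<inter> A\<close> is weakened to \<open>B\<close>;
      the second is carried back to itself and weakened to \<open>A\<close>.\<close>
    moreover have "inv (\<phi> k) <# ((B \<inter> A) \<inter> (\<phi> k <# (B \<inter> A))) \<subseteq> (inv (\<phi> k) <# B) \<inter> A"
    proof -
      have "inv (\<phi> k) <# ((B \<inter> A) \<inter> (\<phi> k <# (B \<inter> A))) \<subseteq>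
          (inv (\<phi> k) <# B) \<inter> (inv (\<phi> k) <# (\<phi> k <# (B \<inter> A)))"
        by (auto simp: l_coset_def)
      also have "inv (\<phi> k) <# (\<phi> k <# (B \<inter> A)) = B \<inter> A"
        using lcos_m_assoc[of "B \<inter> A" "inv (\<phi> k)" "\<phi> k"] lcos_mult_one[of "B \<inter> A"]
          B \<phi>[OF that(2)] by (simp add: le_infI1)
      finally show ?thesis by blast
    qed
    ultimately show ?thesis
      using positive_density_mono l_coset_subset_G[OF B] \<phi>[OF that(2)] by blast
  qed
  then have "good_family A \<B>'"
    using \<B> \<open>finite K\<close> unfolding good_family_def \<B>'_def by auto
  then show ?thesis using ij unfolding \<B>'_def \<phi>_def by blast
qed

lemma interval_products_in_difference_set:
  assumes A: "A \<subseteq> carrier G" "positive_density G A"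
    and K: "\<And>n. finite (K n)"
    and coeffs: "\<forall>n. \<forall>k\<in>K n. \<forall>m. c k m \<in> carrier G"
  shows "\<exists>p q :: nat \<Rightarrow> nat. (\<forall>n. p n < q n) \<and> (\<forall>n. q n \<le> p (Suc n)) \<and>
    (\<forall>F x. finite F \<longrightarrow>
      (\<forall>e\<in>F. x e = \<one> \<or> (\<exists>k\<in>K e. x e = ordered_prod G (c k) {p e..<q e})) \<longrightarrow>
      ordered_prod G x F \<in> A <#> set_inv A)"
proof -
  have c: "c k m \<in> carrier G" if "k \<in> K n" for n k m
    using coeffs that by blast
  \<comment> \<open>A state holds the right end of the latest interval and the current family; the
    new interval runs from \<open>i\<close> to the new right end.\<close>
  define Q where "Q = (\<lambda>n (s :: nat \<times> 'a set set) s'. \<exists>i. fst s \<le> i \<and> i < fst s' \<and>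
    snd s \<subseteq> snd s' \<and> (\<forall>B\<in>snd s. \<forall>k\<in>K n. inv (ordered_prod G (c k) {i..<fst s'}) <# B \<in> snd s'))"
  have "\<exists>s. \<forall>n. (A \<in> snd (s n) \<and> good_family A (snd (s n))) \<and> Q n (s n) (s (Suc n))"
  proof (rule dependent_nat_choice)
    show "\<exists>s :: nat \<times> 'a set set. A \<in> snd s \<and> good_family A (snd s)"
      using A by (intro exI[of _ "(0, {A})"]) (simp add: good_family_def)
    fix s :: "nat \<times> 'a set set" and n
    assume s: "A \<in> snd s \<and> good_family A (snd s)"
    then have "\<exists>i j \<B>'. fst s \<le> i \<and> i < j \<and> good_family A \<B>' \<and> snd s \<subseteq> \<B>' \<and>
      (\<forall>B\<in>snd s. \<forall>k\<in>K n. inv (ordered_prod G (c k) {i..<j}) <# B \<in> \<B>')"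
      using A K c by (intro good_family_step) auto
    then obtain i j \<B>' where "fst s \<le> i" "i < j" "good_family A \<B>'" "snd s \<subseteq> \<B>'"
      "\<forall>B\<in>snd s. \<forall>k\<in>K n. inv (ordered_prod G (c k) {i..<j}) <# B \<in> \<B>'" by blast
    then show "\<exists>s'. (A \<in> snd s' \<and> good_family A (snd s')) \<and> Q n s s'"
      using s unfolding Q_def by (intro exI[of _ "(j, \<B>')"]) auto
  qed
  then obtain s where s: "\<And>n. A \<in> snd (s n)" "\<And>n. good_family A (snd (s n))"
    "\<And>n. Q n (s n) (s (Suc n))" by blast
  have "\<forall>n. \<exists>i. fst (s n) \<le> i \<and> i < fst (s (Suc n)) \<and> snd (s n) \<subseteq> snd (s (Suc n)) \<and>
      (\<forall>B\<in>snd (s n). \<forall>k\<in>K n.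
        inv (ordered_prod G (c k) {i..<fst (s (Suc n))}) <# B \<in> snd (s (Suc n)))"
    using s(3) unfolding Q_def by blast
  from choice[OF this] obtain p where p: "\<And>n. fst (s n) \<le> p n" "\<And>n. p n < fst (s (Suc n))"
    "\<And>n. snd (s n) \<subseteq> snd (s (Suc n))"
    "\<And>n B k. B \<in> snd (s n) \<Longrightarrow> k \<in> K n \<Longrightarrow>
      inv (ordered_prod G (c k) {p n..<fst (s (Suc n))}) <# B \<in> snd (s (Suc n))"
    by blast
  define q where "q = (\<lambda>n. fst (s (Suc n)))"
  \<comment> \<open>Induction on a bound for the indices: the last factor is peeled off on the
    right. A missing index or a trivial factor costs nothing because the families increase.\<close>
  have inverse_translate: "inv (ordered_prod G x F) <# A \<in> snd (s n)"
    if "F \<subseteq> {..<n}" and "\<And>e. e \<in> F \<Longrightarrow> x e \<in> carrier G"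
      and "\<And>e. e \<in> F \<Longrightarrow> x e = \<one> \<or> (\<exists>k\<in>K e. x e = ordered_prod G (c k) {p e..<q e})" for F x n
    using that
  proof (induction n arbitrary: F)
    case 0
    then show ?case using s(1) A(1) by (simp add: lcos_mult_one)
  next
    case (Suc n)
    show ?case
    proof (cases "n \<in> F")
      case False
      then have "F \<subseteq> {..<n}" using Suc.prems(1) by (auto simp: less_Suc_eq)
      from Suc.IH[OF this Suc.prems(2,3)] show ?thesis using p(3) by blast
    next
      case True
      define F' where "F' = F - {n}"
      have F': "F = insert n F'" "F' \<subseteq> {..<n}" "finite F'"
        using True Suc.prems(1) finite_subset[of F "{..<Suc n}"]
        by (auto simp: F'_def less_Suc_eq)
      have IH: "inv (ordered_prod G x F') <# A \<in> snd (s n)"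
        by (rule Suc.IH[OF F'(2)]) (use F'(1) Suc.prems(2,3) in auto)
      have xF': "ordered_prod G x F' \<in> carrier G"
        using F' Suc.prems(2) by (intro ordered_prod_closed) auto
      have xn: "x n \<in> carrier G" using Suc.prems(2) True by blast
      have "ordered_prod G x F = ordered_prod G x F' \<otimes> x n"
        unfolding F'(1) using F' Suc.prems(2) by (intro ordered_prod_insert_greatest) auto
      then have eq: "inv (ordered_prod G x F) <# A = inv (x n) <# (inv (ordered_prod G x F') <# A)"
        using xF' xn A(1) by (simp add: inv_mult_group lcos_m_assoc)
      from Suc.prems(3)[OF True] show ?thesis
      proof
        assume "x n = \<one>"
        then show ?thesis
          using IH p(3)[of n] xF' A(1) unfolding eq
          by (auto simp: lcos_mult_one l_coset_subset_G)
      next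
        assume "\<exists>k\<in>K n. x n = ordered_prod G (c k) {p n..<q n}"
        then show ?thesis using p(4)[OF IH] unfolding eq q_def by auto
      qed
    qed
  qed
  show ?thesis
  proof (rule exI[of _ p], rule exI[of _ q], intro conjI allI impI)
    show "p n < q n" "q n \<le> p (Suc n)" for n using p by (auto simp: q_def)
    fix F :: "nat set" and x
    assume "finite F"
      and "\<forall>e\<in>F. x e = \<one> \<or> (\<exists>k\<in>K e. x e = ordered_prod G (c k) {p e..<q e})"
    then have x: "x e = \<one> \<or> (\<exists>k\<in>K e. x e = ordered_prod G (c k) {p e..<q e})" if "e \<in> F" for e
      using that by blast
    have xc: "x e \<in> carrier G" if "e \<in> F" for e
      using x[OF that] c by (auto intro!: ordered_prod_closed)
    obtain n where "F \<subseteq> {..<n}" using \<open>finite F\<close> finite_nat_iff_bounded by blast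
    then have "inv (ordered_prod G x F) <# A \<in> snd (s n)" using inverse_translate xc x by blast
    then have pos: "positive_density G ((inv (ordered_prod G x F) <# A) \<inter> A)"
      using s(2) by (simp add: good_family_def)
    have X: "ordered_prod G x F \<in> carrier G" using \<open>finite F\<close> xc by (rule ordered_prod_closed)
    \<comment> \<open>A point of the intersection gives \<open>a = inv x \<otimes> a'\<close> for
      the product \<open>x\<close>, whence \<open>x = a' \<otimes> inv a\<close>.\<close>
    obtain a a' where a: "a \<in> A" "a' \<in> A" "a = inv (ordered_prod G x F) \<otimes> a'"
      using positive_density_nonempty[OF pos] by (auto simp: l_coset_def)
    have ac: "a \<in> carrier G" "a' \<in> carrier G" using a A(1) by auto
    have "a' = ordered_prod G x F \<otimes> a" using a(3) X ac by (simp add: inv_solve_left)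
    then have "ordered_prod G x F = a' \<otimes> inv a"
      using X ac by (simp add: inv_solve_right)
    then show "ordered_prod G x F \<in> A <#> set_inv A"
      using a unfolding set_mult_def SET_INV_def by blast
  qed
qed

end

section \<open>From interval products to substituted words\<close>

theorem theorem7p5:
  fixes G :: "('g, 'm) monoid_scheme" (structure)
    and T :: "'t set" and r :: 't and E :: "('t \<times> 't) set"
    and A L :: "'g set"
    and g :: "nat \<Rightarrow> 't \<Rightarrow> 'g"
    and \<F> :: "nat \<Rightarrow> ('g + 't \<rightharpoonup> 'g + 't) set"
  assumes "amenable_group G"
    and "finite_rooted_tree T r E"
    and "A \<subseteq> carrier G" and "positive_density G A"
    and "L \<subseteq> carrier G"
    and "\<And>n. g n \<in> T - {r} \<rightarrow> carrier G"
    and "\<And>n. finite (\<F> n)"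
    and "\<And>n \<sigma>. \<sigma> \<in> \<F> n \<Longrightarrow> var_subst_map L T r E \<sigma>"
  shows "\<exists>b :: nat \<Rightarrow> 't \<Rightarrow> (nat \<rightharpoonup> 'g + 't).
    (\<forall>n. \<forall>t\<in>T. b n t \<in> FIN_node L T r E t) \<and>
    (\<forall>n. \<forall>t\<in>T. \<forall>i\<in>dom (b n t). \<forall>j\<in>dom (b (Suc n) t). i < j) \<and>
    (\<forall>(F :: nat set) (\<sigma> :: nat \<Rightarrow> ('g + 't \<rightharpoonup> 'g + 't)) (t :: nat \<Rightarrow> 't).
       finite F \<longrightarrow> F \<noteq> {} \<longrightarrow>
       (\<forall>e\<in>F. \<sigma> e \<in> \<F> e) \<longrightarrow> (\<forall>e\<in>F. t e \<in> T) \<longrightarrow>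
       tree_chain E ((\<lambda>e. subst_node_map r (\<sigma> e) (t e)) ` F) \<longrightarrow>
       ordered_prod G (\<lambda>e. subst_prod G g (\<sigma> e) (b e (t e))) F \<in> A <#> (set_inv A))"
proof -
  interpret group G using assms(1) by (simp add: amenable_group_def)
  \<comment> \<open>All letters or nodes that a substitution in \<open>\<F> n\<close> can put in
    place of a variable; they index the coefficient sequences.\<close>
  define K where "K = (\<lambda>n. {k. \<exists>\<sigma>\<in>\<F> n. \<exists>t\<in>T. \<sigma> (Inr t) = Some k})"
  have "finite T" using assms(2) by (simp add: finite_rooted_tree_def)
  have finK: "finite (K n)" for n
  proof (rule finite_subset)
    show "K n \<subseteq> (\<lambda>(\<sigma>, t). the (\<sigma> (Inr t))) ` (\<F> n \<times> T)"
      by (force simp: K_def)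
    show "finite ((\<lambda>(\<sigma>, t). the (\<sigma> (Inr t))) ` (\<F> n \<times> T))"
      using assms(7) \<open>finite T\<close> by simp
  qed
  define c where "c = (\<lambda>k m. extend_letters (g m) k)"
  have c: "c k m \<in> carrier G" if k: "k \<in> K n" for n k m
  proof -
    obtain \<sigma> t where "\<sigma> \<in> \<F> n" "\<sigma> (Inr t) = Some k" using k by (auto simp: K_def)
    then have "k \<in> L <+> (T - {r})"
      using assms(8)[of \<sigma> n] unfolding var_subst_map_def by (blast intro: ranI)
    then show ?thesis
      using assms(5) assms(6)[of m] by (auto simp: c_def extend_letters_def)
  qed
  then have coeffs: "\<forall>n. \<forall>k\<in>K n. \<forall>m. c k m \<in> carrier G" by blast
  obtain p q where pq: "\<And>n. p n < q n" "\<And>n. q n \<le> p (Suc n)"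
    and prods: "\<forall>F x. finite F \<longrightarrow>
      (\<forall>e\<in>F. x e = \<one> \<or> (\<exists>k\<in>K e. x e = ordered_prod G (c k) {p e..<q e})) \<longrightarrow>
      ordered_prod G x F \<in> A <#> set_inv A"
    using interval_products_in_difference_set[where c = c and K = K, OF assms(3,4) finK coeffs]
    by auto
  \<comment> \<open>The interval is the same for every node \<open>t \<noteq> r\<close>. As
    \<open>p n < q n\<close>, the variable \<open>t\<close> does occur, as membership in
    \<open>FIN_node\<close> demands.\<close>
  define b :: "nat \<Rightarrow> 't \<Rightarrow> (nat \<rightharpoonup> 'g + 't)" where
    "b = (\<lambda>n t j. if t \<noteq> r \<and> j \<in> {p n..<q n} then Some (Inr t) else None)"
  have dom_b: "dom (b n t) = (if t = r then {} else {p n..<q n})" for n t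
    by (auto simp: b_def dom_def)
  have ran_b: "ran (b n t) = (if t = r then {} else {Inr t})" for n t
    using pq(1)[of n] by (auto simp: b_def ran_def intro: exI[of _ "p n"])
  have node: "b n t \<in> FIN_node L T r E t" if "t \<in> T" for n t
    using that
    by (auto simp: FIN_node_def FIN_def dom_b ran_b tree_chain_def tree_le_def
        Complete_Partial_Order.chain_def)
  have increasing: "i < j" if "i \<in> dom (b n t)" "j \<in> dom (b (Suc n) t)" for n t i j
    using that pq(2)[of n] by (auto simp: dom_b split: if_splits)
  have factor: "subst_prod G g \<sigma> (b e t) = \<one> \<or>
      (\<exists>k\<in>K e. subst_prod G g \<sigma> (b e t) = ordered_prod G (c k) {p e..<q e})"
    if "\<sigma> \<in> \<F> e" "t \<in> T" for e \<sigma> t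
  \<comment> \<open>Either no position survives the substitution and the product is empty, or every
    position in the interval carries the same value \<open>k\<close>.\<close>
  proof (cases "t = r \<or> \<sigma> (Inr t) = None")
    case True
    then have "dom (\<sigma> \<circ>\<^sub>m b e t) = {}"
      by (auto simp: map_comp_def b_def split: option.splits if_splits)
    then show ?thesis by (simp add: subst_prod_def)
  next
    case False
    then obtain k where k: "\<sigma> (Inr t) = Some k" by blast
    have "k \<in> K e" using that k by (auto simp: K_def)
    have comp: "\<sigma> \<circ>\<^sub>m b e t = (\<lambda>j. if j \<in> {p e..<q e} then Some k else None)"
      using False k by (auto simp: map_comp_def b_def)
    then have "dom (\<sigma> \<circ>\<^sub>m b e t) = {p e..<q e}" by (auto simp: dom_def)
    then have "subst_prod G g \<sigma> (b e t) = ordered_prod G (c k) {p e..<q e}"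
      unfolding subst_prod_def ordered_prod_def comp
      by (auto simp: c_def intro!: arg_cong[where f = "\<lambda>xs. foldr (\<otimes>) xs \<one>"])
    then show ?thesis using \<open>k \<in> K e\<close> by blast
  qed
  show ?thesis
  proof (rule exI[of _ b], intro conjI allI ballI impI)
    fix F :: "nat set" and \<sigma> :: "nat \<Rightarrow> ('g + 't \<rightharpoonup> 'g + 't)" and t :: "nat \<Rightarrow> 't"
    assume "finite F" "\<forall>e\<in>F. \<sigma> e \<in> \<F> e" "\<forall>e\<in>F. t e \<in> T"
    then show "ordered_prod G (\<lambda>e. subst_prod G g (\<sigma> e) (b e (t e))) F \<in> A <#> set_inv A"
      using factor by (intro prods[rule_format]) auto
  qed (use node increasing in auto)
qed

end
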